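(* Let $m\geq 3$ and $n\geq 2$ be integers. Then $$D_n=\left\lfloor\left(\frac{\lfloor e\,(n+m-2)!\rfloor}{(n+m-2)!}+\frac{n+m}{(n+m-1)\,(n+m-1)!}+e^{-1}\right)n!\right\rfloor-\lfloor e\, n!\rfloor .$$
   Context: $D_n$ denotes the number of derangements of $n$ distinct objects (permutations of an $n$-element set with no fixed point). $\lfloor x\rfloor$ denotes the floor of $x$. *)

theory Defs
  imports Complex_Main "HOL-Combinatorics.Permutations"
begin

definition derangements :: "'a set \<Rightarrow> ('a \<Rightarrow> 'a) set" where
  "derangements S = {p. p permutes S \<and> (\<forall>x\<in>S. p x \<noteq> x)}"

definition num_derangements :: "nat \<Rightarrow> nat" where
  "num_derangements n = card (derangements {1..n})"

end

theory Submission
  imports Defs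
begin

text \<open>
  Let \<open>S\<^sub>k\<close> and \<open>T\<^sub>k\<close> be the sums of the terms of degree at most \<open>k\<close> in the exponential series of
  \<open>e\<close> and \<open>e\<^sup>-\<^sup>1\<close>, and \<open>U\<^sub>k = S\<^sub>k + (k+2) / ((k+1) (k+1)!)\<close>. The sequence \<open>U\<close> decreases to \<open>e\<close>, so
  \<open>S\<^sub>k \<le> e \<le> U\<^sub>k\<close> and \<open>\<lfloor>e k!\<rfloor> = S\<^sub>k k!\<close>. With \<open>N = n+m-2 \<ge> n\<close> the bracket in the theorem is therefore
  \<open>U\<^sub>N + e\<^sup>-\<^sup>1\<close>, while \<open>D\<^sub>n = T\<^sub>n n!\<close> by Moebius inversion. Since \<open>\<bar>e\<^sup>-\<^sup>1 - T\<^sub>n\<bar> \<le> e - S\<^sub>n\<close> and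
  \<open>e \<le> U\<^sub>N \<le> U\<^sub>n\<close>, the number \<open>(U\<^sub>N + e\<^sup>-\<^sup>1) n!\<close> exceeds the integer \<open>(S\<^sub>n + T\<^sub>n) n!\<close> by
  at least 0 and at most \<open>2 (U\<^sub>n - S\<^sub>n) n! = 2 (n+2) / (n+1)\<^sup>2 < 1\<close>.
\<close>

text \<open>Every permutation of \<open>S\<close> is a derangement of exactly one subset, namely its
  set of moved points, so these classes partition all permutations.\<close>

lemma fact_eq_sum_card_derangements:
  assumes "finite S"
  shows "fact (card S) = (\<Sum>T\<in>Pow S. card (derangements T))"
proof -
  have "{p. p permutes S} = (\<Union>T\<in>Pow S. derangements T)"
  proof (intro equalityI subsetI)
    fix p assume "p \<in> {p. p permutes S}"
    then have p: "p permutes S" by simp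
    then have "{x. p x \<noteq> x} \<subseteq> S"
      by (auto simp: permutes_def)
    moreover have "p \<in> derangements {x. p x \<noteq> x}"
      using p by (auto simp: derangements_def permutes_def)
    ultimately show "p \<in> (\<Union>T\<in>Pow S. derangements T)" by blast
  qed (auto simp: derangements_def intro: permutes_subset)
  moreover have "card (\<Union>T\<in>Pow S. derangements T) = (\<Sum>T\<in>Pow S. card (derangements T))"
  proof (rule card_UN_disjoint)
    have "finite T" if "T \<subseteq> S" for T
      using that assms finite_subset by blast
    then show "\<forall>T\<in>Pow S. finite (derangements T)"
      by (auto simp: derangements_def intro: finite_subset[OF _ finite_permutations])
    have "T = {x. p x \<noteq> x}" if "p \<in> derangements T" for p :: "'a \<Rightarrow> 'a" and T
      using that by (auto simp: derangements_def permutes_def)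
    then show "\<forall>T\<in>Pow S. \<forall>T'\<in>Pow S. T \<noteq> T' \<longrightarrow> derangements T \<inter> derangements T' = {}"
      by blast
  qed (use assms in simp)
  ultimately show ?thesis
    using card_permutations[OF refl assms] by simp
qed

lemma sum_Pow_card:
  fixes f :: "nat \<Rightarrow> 'b::comm_semiring_1"
  assumes "finite S"
  shows "(\<Sum>T\<in>Pow S. f (card T)) = (\<Sum>k\<le>card S. of_nat (card S choose k) * f k)"
proof -
  have "(\<Sum>T\<in>Pow S. f (card T)) =
      (\<Sum>k\<le>card S. \<Sum>T | T \<in> Pow S \<and> card T = k. f (card T))"
    using assms by (intro sum.group[symmetric]) (auto intro: card_mono)
  also have "\<dots> = (\<Sum>k\<le>card S. of_nat (card S choose k) * f k)"
    using assms by (intro sum.cong) (auto simp: n_subsets)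
  finally show ?thesis .
qed

text \<open>Moebius inversion of the preceding count over the subset lattice; grouping subsets by
  size, \<open>(n choose k) * k! = n! / (n-k)!\<close> produces the series terms.\<close>

lemma card_derangements:
  assumes "finite S"
  shows "real (card (derangements S)) = (\<Sum>k\<le>card S. (-1) ^ k / fact k) * fact (card S)"
proof -
  let ?n = "card S"
  have "real (card (derangements S)) = (\<Sum>T\<in>Pow S. (-1) ^ (?n - card T) * fact (card T))"
  proof (rule inclusion_exclusion_mobius[OF _ assms])
    fix A :: "'a set" assume "finite A"
    then have "real (fact (card A)) = real (\<Sum>T\<in>Pow A. card (derangements T))"
      by (simp only: fact_eq_sum_card_derangements)
    then show "fact (card A) = (\<Sum>T\<in>Pow A. real (card (derangements T)))" by simp
  qed
  also have "\<dots> = (\<Sum>k\<le>?n. real (?n choose k) * ((-1) ^ (?n - k) * fact k))"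
    by (rule sum_Pow_card[OF assms])
  also have "\<dots> = (\<Sum>k\<le>?n. (-1) ^ (?n - k) / fact (?n - k) * fact ?n)"
    by (intro sum.cong) (auto simp: binomial_fact)
  also have "\<dots> = (\<Sum>k\<le>?n. (-1) ^ k / fact k * fact ?n)"
    by (rule sum.nat_diff_reindex[of "\<lambda>k. (-1) ^ k / fact k * fact ?n" "Suc ?n",
          unfolded lessThan_Suc_atMost, simplified])
  finally show ?thesis by (simp add: sum_distrib_right)
qed

definition exp_lower :: "nat \<Rightarrow> real" where
  "exp_lower n = (\<Sum>k\<le>n. 1 / fact k)"

definition exp_upper :: "nat \<Rightarrow> real" where
  "exp_upper n = exp_lower n + (real n + 2) / ((real n + 1) * fact (n + 1))"

lemma exp_lower_sums: "(\<lambda>k. 1 / fact k) sums exp (1::real)"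
  using exp_converges[of "1::real"] by (simp add: field_simps)

lemma exp_lower_le_exp: "exp_lower n \<le> exp 1"
  unfolding exp_lower_def using exp_lower_sums
  by (intro sum_le_suminf[of _ "{..n}", THEN order_trans])
     (auto simp: sums_iff)

lemma decseq_exp_upper: "decseq exp_upper"
proof (rule decseq_SucI)
  fix n
  \<comment> \<open>After multiplication by \<open>(n+1)!\<close>, the claim reads
    \<open>1 + (n+3)/(n+2)^2 \<le> 1 + 1/(n+1)\<close>, which reduces to this.\<close>
  have "(real n + 3) * (real n + 1) \<le> 1 * (real n + 2)^2"
    by (simp add: algebra_simps power2_eq_square)
  then have "(real n + 3) / (real n + 2)^2 \<le> 1 / (real n + 1)"
    by (subst pos_divide_le_eq, simp, simp only: times_divide_eq_left, subst pos_le_divide_eq) auto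
  then have "1 + (real n + 3) / (real n + 2)^2 \<le> (real n + 2) / (real n + 1)"
    by (simp add: field_simps)
  then have "(1 + (real n + 3) / (real n + 2)^2) / fact (n + 1)
      \<le> (real n + 2) / (real n + 1) / fact (n + 1)"
    by (intro divide_right_mono) auto
  moreover have "exp_upper (Suc n) =
      exp_lower n + (1 + (real n + 3) / (real n + 2)^2) / fact (n + 1)"
    by (simp add: exp_upper_def exp_lower_def power2_eq_square add_divide_distrib add_ac mult_ac)
  ultimately show "exp_upper (Suc n) \<le> exp_upper n"
    by (simp add: exp_upper_def)
qed

lemma exp_le_exp_upper: "exp 1 \<le> exp_upper n"
proof (rule decseq_ge[OF decseq_exp_upper])
  have lower: "exp_lower \<longlonglongrightarrow> exp 1"
    using exp_lower_sums unfolding exp_lower_def[abs_def] sums_def_le .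
  \<comment> \<open>The correction term of \<open>exp_upper\<close> is split into a factor tending
    to 1 and a term of a convergent series, so it vanishes in the limit.\<close>
  have "(\<lambda>n. (1 + 1 / real (Suc n)) * (1 / fact (Suc n))) \<longlonglongrightarrow> (1 + 0) * (0::real)"
    using exp_lower_sums
    by (intro tendsto_intros LIMSEQ_Suc[OF lim_1_over_n] LIMSEQ_Suc[of "\<lambda>n. 1 / fact n"]
          summable_LIMSEQ_zero) (auto simp: sums_iff)
  moreover have "(1 + 1 / real (Suc n)) * (1 / fact (Suc n)) =
      (real n + 2) / ((real n + 1) * fact (n + 1))" for n
    by (simp add: divide_simps) (simp add: algebra_simps)
  ultimately have "(\<lambda>n. (real n + 2) / ((real n + 1) * fact (n + 1))) \<longlonglongrightarrow> 0"
    by simp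
  from tendsto_add[OF lower this] show "exp_upper \<longlonglongrightarrow> exp 1"
    by (simp add: exp_upper_def[abs_def])
qed

lemma exp_upper_minus_lower:
  "(exp_upper n - exp_lower n) * fact n = (real n + 2) / (real n + 1)^2"
  by (simp add: exp_upper_def power2_eq_square divide_simps)

text \<open>Both \<open>1/k! - (-1)^k/k!\<close> and \<open>1/k! + (-1)^k/k!\<close> are
  nonnegative, so partial sums stay below the totals \<open>e - 1/e\<close> and
  \<open>e + 1/e\<close>. These two bounds give the two signs of the absolute value.\<close>

lemma abs_exp_minus_one_remainder_le:
  "\<bar>exp (-1) - (\<Sum>k\<le>n. (-1) ^ k / fact k)\<bar> \<le> exp 1 - exp_lower n"
proof -
  have alt: "(\<lambda>k. (-1) ^ k / fact k) sums exp (-1::real)"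
    using exp_converges[of "-1::real"] by (simp add: field_simps)
  have le: "(-1) ^ k / fact k \<le> (1 / fact k :: real)" "0 \<le> 1 / fact k + (-1) ^ k / (fact k :: real)" for k
    by (cases "even k"; simp)+
  have "(\<Sum>k\<le>n. 1 / fact k - (-1) ^ k / fact k) \<le> exp 1 - exp (-1::real)"
    using sums_diff[OF exp_lower_sums alt] le
    by (intro sum_le_suminf[of _ "{..n}", THEN order_trans]) (auto simp: sums_iff)
  moreover have "(\<Sum>k\<le>n. 1 / fact k + (-1) ^ k / fact k) \<le> exp 1 + exp (-1::real)"
    using sums_add[OF exp_lower_sums alt] le
    by (intro sum_le_suminf[of _ "{..n}", THEN order_trans])
       (auto simp: sums_iff)
  ultimately show ?thesis
    by (simp add: exp_lower_def sum.distrib sum_subtractf)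
qed

lemma exp_lower_fact_Ints: "exp_lower n * fact n \<in> \<int>"
proof -
  have "fact n / fact k \<in> (\<int> :: real set)" if "k \<le> n" for k
  proof -
    obtain c :: nat where "fact n = fact k * c"
      using fact_dvd[OF \<open>k \<le> n\<close>] by (elim dvdE)
    then have "(fact n :: real) = fact k * of_nat c"
      by (metis of_nat_fact of_nat_mult)
    then show ?thesis by simp
  qed
  then show ?thesis
    by (auto simp: exp_lower_def sum_distrib_right intro!: Ints_sum)
qed

text \<open>\<open>exp_lower n * fact n\<close> is an integer, and \<open>e * n!\<close> exceeds it
  by at most \<open>(n+2)/(n+1)^2\<close>, which is below 1 once \<open>n \<ge> 1\<close>. At
  \<open>n = 0\<close> the identity fails: the floor of \<open>e\<close> is 2, but
  \<open>exp_lower 0 = 1\<close>.\<close>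

lemma floor_exp_fact:
  assumes "n \<ge> 1"
  shows "real_of_int \<lfloor>exp (1::real) * fact n\<rfloor> = exp_lower n * fact n"
proof -
  obtain a where a: "exp_lower n * fact n = of_int a"
    using exp_lower_fact_Ints by (metis Ints_cases)
  have "(exp 1 - exp_lower n) * fact n \<le> (exp_upper n - exp_lower n) * fact n"
    using exp_le_exp_upper by (intro mult_right_mono) auto
  also have "\<dots> < 1"
  proof -
    have "1 * 1 \<le> real n * real n"
      using assms by (intro mult_mono) auto
    then have "real n + 2 < (real n + 1)^2"
      using assms by (simp add: power2_eq_square algebra_simps)
    then show ?thesis by (simp add: exp_upper_minus_lower)
  qed
  finally have "exp 1 * fact n < real_of_int a + 1"
    by (simp add: left_diff_distrib a)
  moreover have "of_int a \<le> exp 1 * (fact n :: real)"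
    unfolding a[symmetric] by (intro mult_right_mono exp_lower_le_exp) auto
  ultimately have "\<lfloor>exp 1 * (fact n :: real)\<rfloor> = a"
    by (intro floor_unique) auto
  then show ?thesis by (simp add: a)
qed

theorem theorem6:
  fixes m n :: nat
  assumes "m \<ge> 3" and "n \<ge> 2"
  shows "int (num_derangements n) =
    \<lfloor>(real_of_int \<lfloor>exp (1::real) * fact (n + m - 2)\<rfloor> / fact (n + m - 2)
       + real (n + m) / (real (n + m - 1) * fact (n + m - 1))
       + inverse (exp (1::real))) * fact n\<rfloor>
    - \<lfloor>exp (1::real) * fact n\<rfloor>"
proof -
  define N where "N = n + m - 2"
  define T :: real where "T = (\<Sum>k\<le>n. (-1) ^ k / fact k)"
  have N: "N \<ge> n" "N \<ge> 1" "n + m - 1 = N + 1" "n + m = N + 2"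
    using assms by (auto simp: N_def)
  have upper: "real_of_int \<lfloor>exp (1::real) * fact (n + m - 2)\<rfloor> / fact (n + m - 2)
       + real (n + m) / (real (n + m - 1) * fact (n + m - 1)) = exp_upper N"
    using assms N floor_exp_fact[of N] unfolding N_def[symmetric] N(3,4)
    by (simp add: exp_upper_def add_ac)
  have D: "real (num_derangements n) = T * fact n"
    using card_derangements[of "{1..n}"] by (simp add: num_derangements_def T_def)
  have A: "real_of_int \<lfloor>exp (1::real) * fact n\<rfloor> = exp_lower n * fact n"
    using assms by (intro floor_exp_fact) auto
  have rem: "\<bar>exp (-1) - T\<bar> \<le> exp 1 - exp_lower n"
    unfolding T_def by (rule abs_exp_minus_one_remainder_le)
  have "exp_lower n + T \<le> exp_upper N + exp (-1)"
    using rem exp_le_exp_upper[of N] by linarith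
  then have "(exp_lower n + T) * fact n \<le> (exp_upper N + exp (-1)) * fact n"
    by (intro mult_right_mono) auto
  moreover have "(exp_upper N + exp (-1)) * fact n < (exp_lower n + T) * fact n + 1"
  proof -
    \<comment> \<open>Both \<open>exp_upper N - exp_lower n\<close> and \<open>exp (-1) - T\<close>
      are at most \<open>exp_upper n - exp_lower n\<close>.\<close>
    have "exp_upper N + exp (-1) - (exp_lower n + T) \<le> 2 * (exp_upper n - exp_lower n)"
      using abs_le_D1[OF rem] exp_le_exp_upper[of n] decseqD[OF decseq_exp_upper N(1)]
      by (simp add: algebra_simps)
    then have "(exp_upper N + exp (-1) - (exp_lower n + T)) * fact n
        \<le> 2 * (exp_upper n - exp_lower n) * fact n"
      by (intro mult_right_mono) auto
    also have "\<dots> = 2 * ((real n + 2) / (real n + 1)^2)"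
      by (simp only: mult.assoc exp_upper_minus_lower)
    also have "\<dots> < 1"
    proof -
      \<comment> \<open>The bound \<open>2 (n+2) < (n+1)^2\<close> amounts to
        \<open>n^2 > 3\<close>, hence \<open>n \<ge> 2\<close>.\<close>
      have "2 * 2 \<le> real n * real n"
        using assms by (intro mult_mono) auto
      then show ?thesis by (simp add: field_simps power2_eq_square)
    qed
    finally show ?thesis by (simp add: left_diff_distrib)
  qed
  ultimately have "\<lfloor>(exp_upper N + exp (-1)) * fact n\<rfloor>
      = \<lfloor>exp (1::real) * fact n\<rfloor> + int (num_derangements n)"
    by (intro floor_unique) (simp_all add: A D distrib_right)
  then show ?thesis
    unfolding upper by (simp add: exp_minus)
qed

end
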